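(* Let $G$ be a graph, potentially with loops, whose vertices with loops are $\{z_1,\dots,z_r\}$. Assume $\{x_1,y_1\},\dots,\{x_t,y_t\}$ are disjoint regular edges of $G$ such that for each $2\le i\le t$ either $$N_G(x_i)\cap\{x_1,y_1,\dots,x_{i-1},y_{i-1},z_1,\dots,z_r\}=\emptyset$$ or $$N_G(y_i)\cap\{x_1,y_1,\dots,x_{i-1},y_{i-1},z_1,\dots,z_r\}=\emptyset.$$ Then $x_1+y_1,\,x_2+y_2,\dots,x_t+y_t$ is a regular sequence on $R/I(G)$.
   Context: All graphs are finite. A graph $G$ potentially with loops has a loop at $x\in V(G)$ if $\{x,x\}\in E(G)$. Let $k$ be a field and $R$ the polynomial ring over $k$ with variables the vertices of $G$. The edge ideal is $I(G)=\langle uv \mid \{u,v\}\in E(G)\rangle\subseteq R$ (so a loop at $x$ contributes the generator $x^2$). The neighbor set is $N_G(v)=\{u\mid \{u,v\}\in E(G)\}$. An edge $\{a,b\}$ is identified with the monomial $ab$. Regular edge: an edge $e=\{a,b\}$ of $G$ is regular if for every associated prime $Q$ of $I(G)$ (i.e. of $R/I(G)$) one has $ab\notin Q^2$; that is, precisely one of $a,b$ is in $Q$. Edges are disjoint if they pairwise share no vertex. *)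

theory Defs
  imports
    "HOL-Algebra.QuotRing"
    "HOL-Algebra.Ideal_Product"
    "HOL-Algebra.Module"
    "HOL-Algebra.Algebraic_Closure_Type"
    "HOL-Library.Poly_Mapping"
begin

section \<open>Modules, associated primes and regular sequences\<close>

text \<open>The fields \<open>mult\<close> and \<open>one\<close> play no role for the module structure.\<close>

definition quot_module :: "('a, 'b) ring_scheme \<Rightarrow> 'a set \<Rightarrow> ('a, 'a set) module"
  where "quot_module R I =
    \<lparr>carrier = carrier (R Quot I), monoid.mult = monoid.mult (R Quot I), one = monoid.one (R Quot I),
     zero = ring.zero (R Quot I), add = ring.add (R Quot I),
     module.smult = (\<lambda>r C. (I +>\<^bsub>R\<^esub> r) \<otimes>\<^bsub>R Quot I\<^esub> C)\<rparr>"

lemma quot_module_is_module: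
  assumes "ideal I R" "cring R"
  shows "module R (quot_module R I)"
proof -
  interpret I: ideal I R by fact
  interpret R: cring R by fact
  interpret Q: cring "R Quot I"
    using I.quotient_is_cring[OF \<open>cring R\<close>] .
  interpret h: ring_hom_ring R "R Quot I" "(+>\<^bsub>R\<^esub>) I"
    by (rule I.rcos_ring_hom_ring)
  have ag: "abelian_group (quot_module R I)"
  proof (rule abelian_groupI)
    fix C assume "C \<in> carrier (quot_module R I)"
    then have C: "C \<in> carrier (R Quot I)"
      by (simp add: quot_module_def)
    show "\<exists>Y\<in>carrier (quot_module R I). Y \<oplus>\<^bsub>quot_module R I\<^esub> C = \<zero>\<^bsub>quot_module R I\<^esub>"
      using Q.add.l_inv_ex[OF C] by (auto simp: quot_module_def)
  qed (auto simp: quot_module_def Q.a_ac)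
  show ?thesis
    by (rule moduleI[OF \<open>cring R\<close> ag])
       (auto simp: quot_module_def Q.l_distr Q.r_distr Q.m_assoc)
qed

definition associated_primes :: "('a, 'b) ring_scheme \<Rightarrow> ('a, 'm, 'c) module_scheme \<Rightarrow> 'a set set"
  where "associated_primes R M =
    {Q. primeideal Q R \<and> (\<exists>m\<in>carrier M. Q = {r \<in> carrier R. r \<odot>\<^bsub>M\<^esub> m = \<zero>\<^bsub>M\<^esub>})}"

text \<open>The submodule \<open>(F)M\<close>, where \<open>(F)\<close> is the ideal generated by \<open>F\<close>;
  for \<open>F = {}\<close> it is the zero submodule.\<close>

definition ideal_module_prod :: "('a, 'b) ring_scheme \<Rightarrow> ('a, 'm, 'c) module_scheme \<Rightarrow> 'a set \<Rightarrow> 'm set"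
  where "ideal_module_prod R M F =
    \<Inter>{N. submodule N R M \<and> (\<forall>f\<in>F. \<forall>m\<in>carrier M. f \<odot>\<^bsub>M\<^esub> m \<in> N)}"

text \<open>The first condition says that \<open>fs ! i\<close> is a nonzerodivisor on
  \<open>M / (fs ! 0, \<dots>, fs ! (i - 1))M\<close>, the second that \<open>M / (fs)M\<close> is nonzero.\<close>

definition regular_sequence :: "('a, 'b) ring_scheme \<Rightarrow> ('a, 'm, 'c) module_scheme \<Rightarrow> 'a list \<Rightarrow> bool"
  where "regular_sequence R M fs \<longleftrightarrow>
    set fs \<subseteq> carrier R \<and>
    (\<forall>i<length fs. \<forall>m\<in>carrier M.
       fs ! i \<odot>\<^bsub>M\<^esub> m \<in> ideal_module_prod R M (set (take i fs)) \<longrightarrow>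
       m \<in> ideal_module_prod R M (set (take i fs))) \<and>
    ideal_module_prod R M (set fs) \<noteq> carrier M"

section \<open>Graphs with loops and edge ideals\<close>

text \<open>The vertex set is the whole (finite) type \<open>'v\<close>. A loop at \<open>x\<close> is the edge
  \<open>{x, x} = {x}\<close>.\<close>

definition loop_graph :: "'v::finite set set \<Rightarrow> bool"
  where "loop_graph E \<longleftrightarrow> (\<forall>e\<in>E. \<exists>u v. e = {u, v})"

definition loop_vertices :: "'v set set \<Rightarrow> 'v set"
  where "loop_vertices E = {z. {z, z} \<in> E}"

definition nbhd :: "'v set set \<Rightarrow> 'v \<Rightarrow> 'v set"
  where "nbhd E v = {u. {u, v} \<in> E}"

text \<open>Polynomials over \<open>'k\<close> in the variables \<open>'v\<close>: finitely supported coefficient functions on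
  monomials, which are finitely supported exponent vectors.\<close>

type_synonym ('v, 'k) mpoly = "('v \<Rightarrow>\<^sub>0 nat) \<Rightarrow>\<^sub>0 'k"

abbreviation poly_ring :: "('v, 'k::field) mpoly ring"
  where "poly_ring \<equiv> ring_of_type_algebra"

definition var :: "'v \<Rightarrow> ('v, 'k::field) mpoly"
  where "var v = Poly_Mapping.single (Poly_Mapping.single v 1) 1"

definition edge_ideal :: "'v set set \<Rightarrow> ('v, 'k::field) mpoly set"
  where "edge_ideal E = Idl\<^bsub>poly_ring\<^esub> {var u * var v | u v. {u, v} \<in> E}"

definition edge_module :: "'v set set \<Rightarrow> (('v, 'k::field) mpoly, ('v, 'k) mpoly set) module"
  where "edge_module E = quot_module poly_ring (edge_ideal E)"

text \<open>The first argument fixes the coefficient field.\<close>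

definition regular_edge :: "'k::field itself \<Rightarrow> 'v set set \<Rightarrow> 'v \<Rightarrow> 'v \<Rightarrow> bool"
  where "regular_edge k E a b \<longleftrightarrow>
    {a, b} \<in> E \<and>
    (\<forall>Q \<in> associated_primes poly_ring (edge_module E :: (('v, 'k) mpoly, _) module).
       var a * var b \<notin> ideal_prod poly_ring Q Q)"

end

theory Submission
  imports Defs
begin

text \<open>
  The edge ideal \<open>I\<close> is a monomial ideal, so everything reduces to one condition on the graph. For an
  edge \<open>{x, y}\<close> the condition is that every neighbour \<open>u\<close> of \<open>x\<close> and every neighbour \<open>w\<close> of \<open>y\<close> are
  distinct and adjacent. A regular edge satisfies it (\<open>joined_neighbours_if_regular_edge\<close>): if a pair
  \<open>u\<close>, \<open>w\<close> violates it, take a maximal set \<open>S\<close> containing \<open>u\<close> and \<open>w\<close> with no edge between distinct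
  members. The product \<open>M\<close> of the variables in \<open>S\<close> is not in \<open>I\<close>, and the colon ideal \<open>I : M\<close> is
  generated by variables, hence an associated prime. It contains \<open>x\<close> and \<open>y\<close>, so \<open>xy\<close> lies in its
  square.

  Conversely the condition makes \<open>x + y\<close> a nonzerodivisor modulo \<open>I\<close>
  (\<open>vertex_sum_nonzerodivisor\<close>). If a monomial \<open>m\<close> is outside \<open>I\<close> but \<open>xm\<close> and \<open>ym\<close> are in \<open>I\<close>, then
  \<open>m\<close> is divisible by a neighbour \<open>u\<close> of \<open>x\<close> and a neighbour \<open>w\<close> of \<open>y\<close>, hence by the edge \<open>uw\<close>,
  which is absurd. So no such monomial exists, and a descent on exponents
  (\<open>keys_multiple_if_sum_times_mem\<close>) passes from monomials to polynomials.

  For the sequence, let \<open>J\<close> be \<open>I\<close> together with \<open>x j + y j\<close> for all \<open>j < i\<close>. Modulo \<open>J\<close> the variable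
  \<open>y j\<close> equals \<open>- x j\<close>, and substituting \<open>- x j\<close> for \<open>y j\<close> turns each edge into an edge of the
  contracted graph, up to sign. Thus membership in \<open>J\<close> is membership of the substituted polynomial in
  the edge ideal of the contracted graph (\<open>mem_ideal_contraction_iff\<close>). The edge \<open>{x i, y i}\<close> survives
  the contraction and so does adjacency of its neighbours. Two distinct neighbours \<open>u\<close> of \<open>x i\<close> and
  \<open>w\<close> of \<open>y i\<close> could only be identified if \<open>{u, w} = {x j, y j}\<close> for some \<open>j < i\<close>, and then both
  neighbourhoods would meet the earlier edges, which the hypothesis on neighbourhoods excludes. So
  \<open>x i + y i\<close> is a nonzerodivisor modulo \<open>J\<close>.
\<close>

section \<open>Regular sequences and associated primes of a quotient ring\<close>

lemma ideal_type_algebra_iff: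
  fixes S :: "'a::comm_ring_1 set"
  shows "ideal S ring_of_type_algebra \<longleftrightarrow>
    0 \<in> S \<and> (\<forall>a\<in>S. \<forall>b\<in>S. a + b \<in> S) \<and> (\<forall>a\<in>S. \<forall>r. r * a \<in> S)"
proof
  assume "ideal S ring_of_type_algebra"
  then interpret ideal S "ring_of_type_algebra" .
  show "0 \<in> S \<and> (\<forall>a\<in>S. \<forall>b\<in>S. a + b \<in> S) \<and> (\<forall>a\<in>S. \<forall>r. r * a \<in> S)"
    using additive_subgroup.zero_closed[OF is_additive_subgroup] additive_subgroup.a_closed[OF is_additive_subgroup] I_l_closed
    by (simp add: ring_of_type_algebra_def)
next
  assume S: "0 \<in> S \<and> (\<forall>a\<in>S. \<forall>b\<in>S. a + b \<in> S) \<and> (\<forall>a\<in>S. \<forall>r. r * a \<in> S)"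
  have ring: "ring (ring_of_type_algebra :: 'a ring)" by (rule ring_from_type_algebra)
  then interpret R: ring "ring_of_type_algebra :: 'a ring" .
  have inv: "\<ominus>\<^bsub>ring_of_type_algebra\<^esub> a \<in> S" if "a \<in> S" for a :: 'a
  proof -
    have "\<ominus>\<^bsub>ring_of_type_algebra\<^esub> a = - a"
      by (rule R.minus_equality) (simp_all add: ring_of_type_algebra_def)
    moreover have "(- 1) * a \<in> S" using S that by blast
    ultimately show ?thesis by simp
  qed
  show "ideal S ring_of_type_algebra"
  proof (rule idealI)
    show "subgroup S (add_monoid ring_of_type_algebra)"
    proof (rule R.add.subgroupI)
      show "S \<noteq> {}" using S by blast
      show "a \<oplus>\<^bsub>ring_of_type_algebra\<^esub> b \<in> S" if "a \<in> S" "b \<in> S" for a b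
        using S that by (simp add: ring_of_type_algebra_def)
    qed (use inv in \<open>simp_all add: ring_of_type_algebra_def\<close>)
  next
    fix a r :: 'a assume "a \<in> S"
    then have "r * a \<in> S" using S by blast
    then show "r \<otimes>\<^bsub>ring_of_type_algebra\<^esub> a \<in> S" "a \<otimes>\<^bsub>ring_of_type_algebra\<^esub> r \<in> S"
      by (simp_all add: ring_of_type_algebra_def mult.commute[of a])
  qed (rule ring)
qed

lemma carrier_quot_module: "carrier (quot_module R I) = (\<lambda>a. I +>\<^bsub>R\<^esub> a) ` carrier R"
  by (auto simp: quot_module_def FactRing_simps)

lemma zero_quot_module: "\<zero>\<^bsub>quot_module R I\<^esub> = I"
  by (simp add: quot_module_def FactRing_def)

context ideal
begin

lemma smult_quot_module:
  assumes "r \<in> carrier R" "a \<in> carrier R"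
  shows "r \<odot>\<^bsub>quot_module R I\<^esub> (I +> a) = I +> (r \<otimes> a)"
  using assms by (simp add: quot_module_def FactRing_simps rcoset_mult_add)

lemma add_quot_module:
  assumes "a \<in> carrier R" "b \<in> carrier R"
  shows "(I +> a) \<oplus>\<^bsub>quot_module R I\<^esub> (I +> b) = I +> (a \<oplus> b)"
  using assms by (simp add: quot_module_def FactRing_simps a_rcos_sum)

lemma coset_eq_ideal_iff:
  assumes "a \<in> carrier R"
  shows "I +> a = I \<longleftrightarrow> a \<in> I"
  using assms a_rcos_zero[OF is_ideal] rcos_const_imp_mem by blast

text \<open>
  The cosets of elements of the ideal generated by \<open>I \<union> F\<close> form a submodule containing all products
  from \<open>F\<close>; conversely, the preimage of any such submodule under the quotient map is an ideal that
  contains \<open>I\<close> and \<open>F\<close>.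
\<close>
lemma mem_ideal_module_prod_quot_module:
  assumes R: "cring R" and F: "F \<subseteq> carrier R" and a: "a \<in> carrier R"
  shows "I +> a \<in> ideal_module_prod R (quot_module R I) F \<longleftrightarrow> a \<in> Idl (I \<union> F)"
proof
  interpret cring R by fact
  interpret M: module R "quot_module R I" by (rule quot_module_is_module[OF is_ideal R])
  have IF: "I \<union> F \<subseteq> carrier R" using F by auto
  interpret J: ideal "Idl (I \<union> F)" R by (rule genideal_ideal[OF IF])
  have IJ: "I \<union> F \<subseteq> Idl (I \<union> F)" by (rule genideal_self[OF IF])
  define N where "N = (\<lambda>b. I +> b) ` (Idl (I \<union> F))"
  have sub: "submodule N R (quot_module R I)"
  proof (rule M.submoduleI)
    show "N \<subseteq> carrier (quot_module R I)"
      by (auto simp: N_def carrier_quot_module)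
    show "\<zero>\<^bsub>quot_module R I\<^esub> \<in> N"
      using J.zero_closed coset_eq_ideal_iff[of \<zero>] by (force simp: N_def zero_quot_module)
  next
    fix C assume "C \<in> N"
    then obtain b where b: "b \<in> Idl (I \<union> F)" "C = I +> b" by (auto simp: N_def)
    have "I +> (\<ominus> b) \<in> N" using b by (simp add: N_def)
    moreover have "\<ominus>\<^bsub>quot_module R I\<^esub> C = I +> (\<ominus> b)"
    proof (rule M.minus_equality)
      show "(I +> (\<ominus> b)) \<oplus>\<^bsub>quot_module R I\<^esub> C = \<zero>\<^bsub>quot_module R I\<^esub>"
        using b by (simp add: add_quot_module zero_quot_module l_neg coset_eq_ideal_iff)
    qed (use b in \<open>auto simp: carrier_quot_module\<close>)
    ultimately show "\<ominus>\<^bsub>quot_module R I\<^esub> C \<in> N" by simp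
  next
    fix C D assume "C \<in> N" "D \<in> N"
    then obtain b c where "b \<in> Idl (I \<union> F)" "C = I +> b" "c \<in> Idl (I \<union> F)" "D = I +> c"
      by (auto simp: N_def)
    then show "C \<oplus>\<^bsub>quot_module R I\<^esub> D \<in> N"
      by (auto simp: N_def add_quot_module)
  next
    fix r C assume "r \<in> carrier R" "C \<in> N"
    then show "r \<odot>\<^bsub>quot_module R I\<^esub> C \<in> N"
      by (auto simp: N_def smult_quot_module J.I_l_closed)
  qed
  have gens: "f \<odot>\<^bsub>quot_module R I\<^esub> C \<in> N" if "f \<in> F" "C \<in> carrier (quot_module R I)" for f C
    using that F IJ by (auto simp: N_def carrier_quot_module smult_quot_module subset_iff J.I_r_closed)
  {
    assume "I +> a \<in> ideal_module_prod R (quot_module R I) F"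
    then have "I +> a \<in> N" using sub gens by (auto simp: ideal_module_prod_def)
    then obtain b where b: "b \<in> Idl (I \<union> F)" "I +> a = I +> b" by (auto simp: N_def)
    have "a \<in> I +> b" using a_rcos_self[OF a] b(2) by simp
    then obtain h where "h \<in> I" "a = h \<oplus> b" by (auto simp: a_r_coset_def')
    then show "a \<in> Idl (I \<union> F)" using b IJ by auto
  }
  assume aJ: "a \<in> Idl (I \<union> F)"
  show "I +> a \<in> ideal_module_prod R (quot_module R I) F"
    unfolding ideal_module_prod_def
  proof (rule InterI, elim CollectE conjE)
    fix N assume "submodule N R (quot_module R I)"
      and N: "\<forall>f\<in>F. \<forall>m\<in>carrier (quot_module R I). f \<odot>\<^bsub>quot_module R I\<^esub> m \<in> N"
    then interpret N: submodule N R "quot_module R I" by simp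
    define P where "P = {b \<in> carrier R. I +> b \<in> N}"
    have "I \<union> F \<subseteq> P"
    proof
      fix b assume b: "b \<in> I \<union> F"
      then have bR: "b \<in> carrier R" using IF by blast
      have "I +> b \<in> N"
      proof (cases "b \<in> I")
        case True
        have "\<zero>\<^bsub>quot_module R I\<^esub> \<in> N" using N.one_closed by simp
        moreover have "I +> b = I" using True bR by (simp add: coset_eq_ideal_iff)
        ultimately show ?thesis by (simp add: zero_quot_module)
      next
        case False
        then have "b \<odot>\<^bsub>quot_module R I\<^esub> (I +> \<one>) \<in> N"
          using N b by (auto simp: carrier_quot_module)
        then show ?thesis using bR by (simp add: smult_quot_module)
      qed
      then show "b \<in> P" using bR by (simp add: P_def)
    qed
    moreover have "ideal P R"
    proof (rule idealI)
      show "subgroup P (add_monoid R)"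
      proof (rule add.subgroupI)
        have "\<zero> \<in> P" using \<open>I \<union> F \<subseteq> P\<close> zero_closed by auto
        then show "P \<noteq> {}" by auto
      next
        fix b assume b: "b \<in> P"
        have "(\<ominus> \<one>) \<odot>\<^bsub>quot_module R I\<^esub> (I +> b) \<in> N"
          using b by (intro N.smult_closed) (auto simp: P_def)
        moreover have "(\<ominus> \<one>) \<otimes> b = \<ominus> b" using b by (simp add: P_def l_minus)
        ultimately show "\<ominus> b \<in> P"
          using b by (simp add: P_def smult_quot_module)
      next
        fix b c assume "b \<in> P" "c \<in> P"
        moreover from this have "(I +> b) \<oplus>\<^bsub>quot_module R I\<^esub> (I +> c) \<in> N"
          using N.m_closed by (simp add: P_def)
        ultimately show "b \<oplus> c \<in> P"
          by (simp add: P_def add_quot_module)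
      qed (auto simp: P_def)
    next
      fix b r assume b: "b \<in> P" and r: "r \<in> carrier R"
      have "r \<odot>\<^bsub>quot_module R I\<^esub> (I +> b) \<in> N"
        using b r by (intro N.smult_closed) (auto simp: P_def)
      then show "r \<otimes> b \<in> P" "b \<otimes> r \<in> P"
        using b r by (auto simp: P_def smult_quot_module m_comm)
    qed (rule ring_axioms)
    ultimately have "Idl (I \<union> F) \<subseteq> P" by (intro genideal_minimal)
    then show "I +> a \<in> N" using aJ by (auto simp: P_def)
  qed
qed

lemma regular_sequence_quot_module_iff:
  assumes R: "cring R"
  shows "regular_sequence R (quot_module R I) fs \<longleftrightarrow>
    set fs \<subseteq> carrier R \<and>
    (\<forall>i<length fs. \<forall>a\<in>carrier R.
       fs ! i \<otimes> a \<in> Idl (I \<union> set (take i fs)) \<longrightarrow> a \<in> Idl (I \<union> set (take i fs))) \<and>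
    \<one> \<notin> Idl (I \<union> set fs)"
proof (cases "set fs \<subseteq> carrier R")
  case True
  interpret cring R by fact
  have tk: "set (take i fs) \<subseteq> carrier R" for i
    using True set_take_subset by fast
  have nth: "fs ! i \<in> carrier R" if "i < length fs" for i
    using True that by auto
  have "ideal_module_prod R (quot_module R I) (set fs) = carrier (quot_module R I)
      \<longleftrightarrow> \<one> \<in> Idl (I \<union> set fs)"
  proof
    assume "ideal_module_prod R (quot_module R I) (set fs) = carrier (quot_module R I)"
    then have "I +> \<one> \<in> ideal_module_prod R (quot_module R I) (set fs)"
      by (auto simp: carrier_quot_module)
    then show "\<one> \<in> Idl (I \<union> set fs)"
      by (simp add: mem_ideal_module_prod_quot_module[OF R True])
  next
    assume one: "\<one> \<in> Idl (I \<union> set fs)"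
    interpret J: ideal "Idl (I \<union> set fs)" R
      using True by (intro genideal_ideal) auto
    interpret M: module R "quot_module R I" by (rule quot_module_is_module[OF is_ideal R])
    have "submodule (carrier (quot_module R I)) R (quot_module R I)"
      by (rule M.carrier_is_submodule)
    then have "ideal_module_prod R (quot_module R I) (set fs) \<subseteq> carrier (quot_module R I)"
      using True by (auto simp: ideal_module_prod_def subset_iff)
    moreover have "carrier (quot_module R I) \<subseteq> ideal_module_prod R (quot_module R I) (set fs)"
      using J.one_imp_carrier[OF one]
      by (auto simp: carrier_quot_module mem_ideal_module_prod_quot_module[OF R True])
    ultimately show "ideal_module_prod R (quot_module R I) (set fs) = carrier (quot_module R I)"
      by blast
  qed
  moreover have "(\<forall>m\<in>carrier (quot_module R I).
      fs ! i \<odot>\<^bsub>quot_module R I\<^esub> m \<in> ideal_module_prod R (quot_module R I) (set (take i fs)) \<longrightarrow>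
      m \<in> ideal_module_prod R (quot_module R I) (set (take i fs))) \<longleftrightarrow>
    (\<forall>a\<in>carrier R.
      fs ! i \<otimes> a \<in> Idl (I \<union> set (take i fs)) \<longrightarrow> a \<in> Idl (I \<union> set (take i fs)))"
    if "i < length fs" for i
    using nth[OF that]
    by (simp add: carrier_quot_module ball_simps(9) smult_quot_module
        mem_ideal_module_prod_quot_module[OF R tk])
  ultimately show ?thesis
    unfolding regular_sequence_def using True by simp
qed (simp add: regular_sequence_def)

lemma associated_primes_quot_module:
  "associated_primes R (quot_module R I) =
    {Q. primeideal Q R \<and> (\<exists>m\<in>carrier R. Q = {r \<in> carrier R. r \<otimes> m \<in> I})}"
proof -
  have "{r \<in> carrier R. r \<odot>\<^bsub>quot_module R I\<^esub> (I +> m) = I} = {r \<in> carrier R. r \<otimes> m \<in> I}"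
    if "m \<in> carrier R" for m
    using that by (intro Collect_cong conj_cong refl) (simp add: smult_quot_module coset_eq_ideal_iff)
  then have "(\<exists>m\<in>carrier R. Q = {r \<in> carrier R. r \<odot>\<^bsub>quot_module R I\<^esub> (I +> m) = I}) \<longleftrightarrow>
      (\<exists>m\<in>carrier R. Q = {r \<in> carrier R. r \<otimes> m \<in> I})" for Q
    by (intro bex_cong) simp_all
  then show ?thesis
    by (simp only: associated_primes_def carrier_quot_module zero_quot_module bex_simps)
qed

end

section \<open>Coefficients of products\<close>

lemma poly_mapping_eq_sum_single:
  fixes f :: "'a \<Rightarrow>\<^sub>0 'b::comm_monoid_add"
  shows "f = (\<Sum>m\<in>Poly_Mapping.keys f. Poly_Mapping.single m (Poly_Mapping.lookup f m))"
  by (rule poly_mapping_eqI)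
     (simp add: lookup_sum lookup_single when_def sum.delta' in_keys_iff)

lemma lookup_times:
  fixes f g :: "'a::monoid_add \<Rightarrow>\<^sub>0 'b::semiring_0"
  shows "Poly_Mapping.lookup (f * g) k =
    (\<Sum>(a, b)\<in>Poly_Mapping.keys f \<times> Poly_Mapping.keys g.
      if a + b = k then Poly_Mapping.lookup f a * Poly_Mapping.lookup g b else 0)"
proof -
  have "f * g = (\<Sum>a\<in>Poly_Mapping.keys f. \<Sum>b\<in>Poly_Mapping.keys g.
      Poly_Mapping.single (a + b) (Poly_Mapping.lookup f a * Poly_Mapping.lookup g b))"
    by (subst poly_mapping_eq_sum_single[of f], subst poly_mapping_eq_sum_single[of g])
       (simp only: sum_product mult_single)
  then show ?thesis
    by (simp add: lookup_sum lookup_single when_def sum.cartesian_product split_def)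
qed

lemma lookup_single_times:
  fixes f :: "'a::cancel_comm_monoid_add \<Rightarrow>\<^sub>0 'b::semiring_0"
  shows "Poly_Mapping.lookup (Poly_Mapping.single a c * f) (a + m) = c * Poly_Mapping.lookup f m"
proof (cases "c = 0")
  case False
  then have "Poly_Mapping.keys (Poly_Mapping.single a c) \<times> Poly_Mapping.keys f =
      Pair a ` Poly_Mapping.keys f"
    by auto
  then have "Poly_Mapping.lookup (Poly_Mapping.single a c * f) (a + m) =
      (\<Sum>b\<in>Poly_Mapping.keys f. if b = m then c * Poly_Mapping.lookup f b else 0)"
    by (simp add: lookup_times sum.reindex inj_on_def)
  then show ?thesis by (simp add: in_keys_iff)
qed simp

lemma keys_times_single:
  fixes f :: "'a::cancel_comm_monoid_add \<Rightarrow>\<^sub>0 'b::comm_semiring_1"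
  shows "Poly_Mapping.keys (f * Poly_Mapping.single a 1) = (\<lambda>m. m + a) ` Poly_Mapping.keys f"
proof
  show "Poly_Mapping.keys (f * Poly_Mapping.single a 1) \<subseteq> (\<lambda>m. m + a) ` Poly_Mapping.keys f"
    using keys_mult[of f "Poly_Mapping.single a 1"] by auto
  have "Poly_Mapping.lookup (f * Poly_Mapping.single a 1) (m + a) = Poly_Mapping.lookup f m" for m
    using lookup_single_times[of a 1 f m] by (simp add: mult.commute[of f] add.commute[of m])
  then show "(\<lambda>m. m + a) ` Poly_Mapping.keys f \<subseteq> Poly_Mapping.keys (f * Poly_Mapping.single a 1)"
    by (auto simp: in_keys_iff)
qed

section \<open>Edge ideals as monomial ideals\<close>

text \<open>
  Divisibility of a monomial by some edge, in terms of exponents; a loop has to divide with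
  multiplicity two.
\<close>
definition edge_monomial :: "'v set set \<Rightarrow> ('v \<Rightarrow>\<^sub>0 nat) \<Rightarrow> bool"
  where "edge_monomial E m \<longleftrightarrow> (\<exists>u v. {u, v} \<in> E \<and>
    0 < Poly_Mapping.lookup m u \<and> 0 < Poly_Mapping.lookup m v \<and>
    (u = v \<longrightarrow> 2 \<le> Poly_Mapping.lookup m u))"

lemma edge_monomialI:
  assumes "{u, v} \<in> E" "0 < Poly_Mapping.lookup m u" "0 < Poly_Mapping.lookup m v"
    and "u = v \<Longrightarrow> 2 \<le> Poly_Mapping.lookup m u"
  shows "edge_monomial E m"
  unfolding edge_monomial_def using assms by blast

lemma edge_monomial_add: "edge_monomial E m \<Longrightarrow> edge_monomial E (m + n)"
  unfolding edge_monomial_def by (force simp: lookup_add)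

lemma var_times_var:
  "(var u * var v :: ('v, 'k::field) mpoly) =
    Poly_Mapping.single (Poly_Mapping.single u 1 + Poly_Mapping.single v 1) 1"
  by (simp add: var_def mult_single)

lemma edge_ideal_ideal: "ideal (edge_ideal E :: ('v, 'k::field) mpoly set) poly_ring"
proof -
  interpret R: ring "poly_ring :: ('v, 'k) mpoly ring" by (rule ring_from_type_algebra)
  show ?thesis
    unfolding edge_ideal_def
    by (rule R.genideal_ideal) (simp add: ring_of_type_algebra_def)
qed

lemma edge_ideal_generator:
  assumes "{u, v} \<in> E"
  shows "var u * var v \<in> (edge_ideal E :: ('v, 'k::field) mpoly set)"
  using assms by (auto simp: edge_ideal_def genideal_def)

text \<open>
  The polynomials all of whose monomials are divisible by an edge form an ideal containing the
  generators, and each such polynomial is a sum of multiples of generators.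
\<close>
lemma mem_edge_ideal_iff:
  fixes f :: "('v, 'k::field) mpoly"
  shows "f \<in> edge_ideal E \<longleftrightarrow> (\<forall>m\<in>Poly_Mapping.keys f. edge_monomial E m)"
proof
  define S :: "('v, 'k) mpoly set"
    where "S = {f. \<forall>m\<in>Poly_Mapping.keys f. edge_monomial E m}"
  have "ideal S poly_ring"
    unfolding ideal_type_algebra_iff
  proof (intro conjI ballI allI)
    fix f g assume "f \<in> S" "g \<in> S"
    then show "f + g \<in> S" using keys_add[of f g] by (auto simp: S_def)
  next
    fix f r assume "f \<in> S"
    then show "r * f \<in> S"
      using keys_mult[of r f] edge_monomial_add[of E]
      by (auto simp: S_def subset_iff) (metis add.commute)
  qed (simp add: S_def)
  moreover have "var u * var v \<in> S" if "{u, v} \<in> E" for u v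
  proof -
    have "edge_monomial E (Poly_Mapping.single u 1 + Poly_Mapping.single v 1)"
      by (rule edge_monomialI[OF that]) (simp_all add: lookup_add lookup_single when_def)
    then show ?thesis by (simp add: S_def var_times_var)
  qed
  then have "{var u * var v | u v. {u, v} \<in> E} \<subseteq> S" by blast
  ultimately have "edge_ideal E \<subseteq> S"
    unfolding edge_ideal_def genideal_def by blast
  then show "\<forall>m\<in>Poly_Mapping.keys f. edge_monomial E m" if "f \<in> edge_ideal E"
    using that by (auto simp: S_def)
next
  have zero: "0 \<in> (edge_ideal E :: ('v, 'k) mpoly set)"
    and add: "\<And>a b. a \<in> (edge_ideal E :: ('v, 'k) mpoly set) \<Longrightarrow> b \<in> edge_ideal E \<Longrightarrow> a + b \<in> edge_ideal E"
    and mult: "\<And>a r. a \<in> (edge_ideal E :: ('v, 'k) mpoly set) \<Longrightarrow> r * a \<in> edge_ideal E"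
    using edge_ideal_ideal[of E, where 'k = 'k] by (auto simp: ideal_type_algebra_iff)
  assume f: "\<forall>m\<in>Poly_Mapping.keys f. edge_monomial E m"
  have single: "Poly_Mapping.single m c \<in> edge_ideal E" if D: "edge_monomial E m" for m and c :: 'k
  proof -
    obtain u v where uv: "{u, v} \<in> E" "0 < Poly_Mapping.lookup m u" "0 < Poly_Mapping.lookup m v"
      "u = v \<longrightarrow> 2 \<le> Poly_Mapping.lookup m u"
      using D unfolding edge_monomial_def by blast
    define n where "n = m - (Poly_Mapping.single u 1 + Poly_Mapping.single v 1)"
    have "m = n + (Poly_Mapping.single u 1 + Poly_Mapping.single v 1)"
      using uv by (intro poly_mapping_eqI)
        (auto simp: n_def lookup_add lookup_minus lookup_single when_def)
    then have "Poly_Mapping.single m c = Poly_Mapping.single n c * (var u * var v)"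
      by (simp add: var_times_var mult_single)
    then show ?thesis using mult edge_ideal_generator[OF uv(1)] by metis
  qed
  have "(\<Sum>m\<in>A. Poly_Mapping.single m (Poly_Mapping.lookup f m)) \<in> edge_ideal E"
    if A: "finite A" "A \<subseteq> Poly_Mapping.keys f" for A
    using A by (induction A rule: finite_induct) (use f in \<open>auto simp: zero single add\<close>)
  then show "f \<in> edge_ideal E"
    by (subst poly_mapping_eq_sum_single) simp
qed

section \<open>Nonzerodivisors from joined neighbourhoods\<close>

text \<open>
  The clause \<open>u \<noteq> w\<close> matters when \<open>u\<close> has a loop: then \<open>{u, u}\<close> is an edge, but a single factor \<open>u\<close>
  does not make a monomial divisible by it.
\<close>
definition joined_neighbours :: "'v set set \<Rightarrow> 'v \<Rightarrow> 'v \<Rightarrow> bool"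
  where "joined_neighbours E x y \<longleftrightarrow>
    (\<forall>u\<in>nbhd E x. \<forall>w\<in>nbhd E y. u \<noteq> w \<and> {u, w} \<in> E)"

lemma joined_neighbours_commute: "joined_neighbours E x y \<longleftrightarrow> joined_neighbours E y x"
  unfolding joined_neighbours_def by (metis insert_commute)

text \<open>
  On an edge, \<open>x\<close> is a neighbour of \<open>y\<close>; were it equal to \<open>y\<close> or its own neighbour, it would be a
  common neighbour of both ends.
\<close>
lemma joined_neighbours_neq:
  assumes "{x, y} \<in> E" "joined_neighbours E x y"
  shows "x \<noteq> y" "{x} \<notin> E"
proof -
  have "x \<in> nbhd E y" "y \<in> nbhd E x" using assms(1) by (auto simp: nbhd_def insert_commute)
  then show "x \<noteq> y" using assms(2) by (auto simp: joined_neighbours_def)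
  show "{x} \<notin> E"
  proof
    assume "{x} \<in> E"
    then have "x \<in> nbhd E x" by (simp add: nbhd_def)
    then show False using \<open>x \<in> nbhd E y\<close> assms(2) by (auto simp: joined_neighbours_def)
  qed
qed

text \<open>
  The edge that divides \<open>m x\<close> but not \<open>m\<close> must use the additional factor \<open>x\<close>, so its other end
  already divides \<open>m\<close>. For a loop at \<open>x\<close> the other end is \<open>x\<close> itself.
\<close>
lemma edge_monomial_add_vertex:
  assumes D: "edge_monomial E (m + Poly_Mapping.single x 1)" and m: "\<not> edge_monomial E m"
  obtains u where "u \<in> nbhd E x" "0 < Poly_Mapping.lookup m u"
proof -
  obtain u v where uv: "{u, v} \<in> E"
    "0 < Poly_Mapping.lookup (m + Poly_Mapping.single x 1) u"
    "0 < Poly_Mapping.lookup (m + Poly_Mapping.single x 1) v"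
    "u = v \<longrightarrow> 2 \<le> Poly_Mapping.lookup (m + Poly_Mapping.single x 1) u"
    using D by (auto simp: edge_monomial_def)
  consider "u = x" | "v = x" | "u \<noteq> x" "v \<noteq> x" by blast
  then show thesis
  proof cases
    case 1
    then show thesis using uv
      by (intro that[of v]) (auto simp: nbhd_def insert_commute lookup_add lookup_single when_def split: if_splits)
  next
    case 2
    then show thesis using uv
      by (intro that[of u]) (auto simp: nbhd_def lookup_add lookup_single when_def split: if_splits)
  next
    case 3
    then have "edge_monomial E m"
      using uv by (auto simp: edge_monomial_def lookup_add lookup_single when_def)
    then show thesis using m by contradiction
  qed
qed

text \<open>
  Otherwise \<open>m\<close> would be divisible by a neighbour of \<open>x\<close> and by a neighbour of \<open>y\<close>, whose product is
  an edge.
\<close>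
lemma edge_monomial_if_both_multiples:
  assumes "joined_neighbours E x y"
    and "edge_monomial E (m + Poly_Mapping.single x 1)"
    and "edge_monomial E (m + Poly_Mapping.single y 1)"
  shows "edge_monomial E m"
proof (rule ccontr)
  assume m: "\<not> edge_monomial E m"
  obtain u w where "u \<in> nbhd E x" "0 < Poly_Mapping.lookup m u"
    "w \<in> nbhd E y" "0 < Poly_Mapping.lookup m w"
    using edge_monomial_add_vertex[OF assms(2) m] edge_monomial_add_vertex[OF assms(3) m] by metis
  then have "edge_monomial E m"
    using assms(1) unfolding joined_neighbours_def edge_monomial_def by metis
  then show False using m by contradiction
qed

text \<open>
  If a monomial \<open>m\<close> of \<open>f\<close> violated the conclusion, the term \<open>x m\<close> would have to cancel in the product
  against a term \<open>y n\<close> with \<open>n\<close> in \<open>f\<close>. Then \<open>n\<close> has smaller degree in \<open>y\<close> and is divisible by \<open>x\<close>.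
  By induction an edge divides \<open>n x\<close>; as \<open>x\<close> has no loop and already divides \<open>n\<close>, that edge divides
  \<open>n\<close> and therefore \<open>y n = x m\<close>.
\<close>
lemma keys_multiple_if_sum_times_mem:
  fixes f :: "('v, 'k::field) mpoly"
  assumes xy: "x \<noteq> y" and x: "{x} \<notin> E" and prod: "(var x + var y) * f \<in> edge_ideal E"
  shows "m \<in> Poly_Mapping.keys f \<Longrightarrow> edge_monomial E (m + Poly_Mapping.single x 1)"
proof (induction "Poly_Mapping.lookup m y" arbitrary: m rule: less_induct)
  case less
  show ?case
  proof (rule ccontr)
    assume mx: "\<not> edge_monomial E (m + Poly_Mapping.single x 1)"
    have "Poly_Mapping.lookup ((var x + var y) * f) (m + Poly_Mapping.single x 1) = 0"
      using mx prod by (auto simp: mem_edge_ideal_iff in_keys_iff)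
    moreover have "Poly_Mapping.lookup (var x * f) (m + Poly_Mapping.single x 1) = Poly_Mapping.lookup f m"
      using lookup_single_times[of "Poly_Mapping.single x 1" 1 f m] by (simp add: var_def add.commute)
    ultimately have "Poly_Mapping.lookup (var y * f) (m + Poly_Mapping.single x 1) \<noteq> 0"
      using less.prems by (auto simp: distrib_right lookup_add in_keys_iff)
    then have "m + Poly_Mapping.single x 1 \<in> Poly_Mapping.keys (var y * f)"
      by (simp add: in_keys_iff)
    then obtain n where n: "n \<in> Poly_Mapping.keys f"
      and eq: "m + Poly_Mapping.single x 1 = Poly_Mapping.single y 1 + n"
      using keys_mult[of "var y" f] by (auto simp: var_def)
    have ly: "Poly_Mapping.lookup m y = Suc (Poly_Mapping.lookup n y)"
      using arg_cong[OF eq, of "\<lambda>k. Poly_Mapping.lookup k y"] xy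
      by (simp add: lookup_add lookup_single when_def)
    have lx: "0 < Poly_Mapping.lookup n x"
      using arg_cong[OF eq, of "\<lambda>k. Poly_Mapping.lookup k x"] xy
      by (simp add: lookup_add lookup_single when_def)
    have nx: "edge_monomial E (n + Poly_Mapping.single x 1)"
      using less.hyps[OF _ n] ly by simp
    have "edge_monomial E n"
    proof (rule ccontr)
      assume "\<not> edge_monomial E n"
      moreover obtain u where u: "u \<in> nbhd E x" "0 < Poly_Mapping.lookup n u"
        using edge_monomial_add_vertex[OF nx calculation] .
      moreover have "u \<noteq> x" using u(1) x by (auto simp: nbhd_def)
      ultimately show False using lx unfolding edge_monomial_def nbhd_def by blast
    qed
    then have "edge_monomial E (m + Poly_Mapping.single x 1)"
      unfolding eq add.commute[of _ n] by (rule edge_monomial_add)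
    then show False using mx by contradiction
  qed
qed

lemma vertex_sum_nonzerodivisor:
  fixes f :: "('v, 'k::field) mpoly"
  assumes edge: "{x, y} \<in> E" and joined: "joined_neighbours E x y"
    and prod: "(var x + var y) * f \<in> edge_ideal E"
  shows "f \<in> edge_ideal E"
proof -
  have edge': "{y, x} \<in> E" and joined': "joined_neighbours E y x"
    and prod': "(var y + var x) * f \<in> edge_ideal E"
    using edge joined prod by (simp_all add: insert_commute[of y] joined_neighbours_commute[of E y] add.commute[of "var y"])
  show ?thesis
    unfolding mem_edge_ideal_iff
    using edge_monomial_if_both_multiples[OF joined]
      keys_multiple_if_sum_times_mem[OF joined_neighbours_neq[OF edge joined] prod]
      keys_multiple_if_sum_times_mem[OF joined_neighbours_neq[OF edge' joined'] prod']
    by blast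
qed

section \<open>Neighbourhoods of a regular edge\<close>

text \<open>
  The ideal generated by the variables in \<open>W\<close> is prime. If neither \<open>f\<close> nor \<open>g\<close> lies in it, take in each
  the largest monomial that avoids \<open>W\<close>, for a monomial order; the product of the two occurs in \<open>f g\<close>
  without cancellation and avoids \<open>W\<close>.
\<close>
lemma primeideal_variables:
  "primeideal {f :: ('v::finite, 'k::field) mpoly.
    \<forall>m\<in>Poly_Mapping.keys f. \<exists>v\<in>W. 0 < Poly_Mapping.lookup m v} poly_ring"
    (is "primeideal ?Q _")
proof -
  define avoids :: "('v \<Rightarrow>\<^sub>0 nat) \<Rightarrow> bool"
    where "avoids m \<longleftrightarrow> (\<forall>v\<in>W. Poly_Mapping.lookup m v = 0)" for m
  have Q: "?Q = {f. \<forall>m\<in>Poly_Mapping.keys f. \<not> avoids m}"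
    by (auto simp: avoids_def)
  have avoids_add: "avoids (a + b) \<longleftrightarrow> avoids a \<and> avoids b" for a b
    by (auto simp: avoids_def lookup_add)
  \<comment> \<open>The type of vertices carries no order, so a monomial order is pulled back along a
    numbering of the vertices.\<close>
  obtain idx :: "'v \<Rightarrow> nat" where idx: "inj idx"
    using finite_imp_inj_to_nat_seg[of "UNIV :: 'v set"] by auto
  define ord :: "('v \<Rightarrow>\<^sub>0 nat) \<Rightarrow> (nat \<Rightarrow>\<^sub>0 nat)"
    where "ord m = (\<Sum>v\<in>UNIV. Poly_Mapping.single (idx v) (Poly_Mapping.lookup m v))" for m
  have ord_add: "ord (a + b) = ord a + ord b" for a b
    by (simp add: ord_def lookup_add single_add sum.distrib)
  have "Poly_Mapping.lookup (ord m) (idx v) = Poly_Mapping.lookup m v" for m v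
    using idx by (simp add: ord_def lookup_sum lookup_single when_def inj_eq sum.delta')
  then have ord_inj: "a = b" if "ord a = ord b" for a b
    using that by (metis poly_mapping_eqI)
  have leading: "\<exists>a\<in>Poly_Mapping.keys f. avoids a \<and>
      (\<forall>a'\<in>Poly_Mapping.keys f. avoids a' \<longrightarrow> ord a' \<le> ord a)"
    if "f \<notin> ?Q" for f :: "('v, 'k) mpoly"
  proof -
    let ?A = "{a \<in> Poly_Mapping.keys f. avoids a}"
    have fin: "finite (ord ` ?A)" and "ord ` ?A \<noteq> {}" using that by (auto simp: Q)
    then have "Max (ord ` ?A) \<in> ord ` ?A" by (rule Max_in)
    then obtain a where a: "a \<in> ?A" "ord a = Max (ord ` ?A)" by (elim imageE) simp
    moreover have "ord a' \<le> ord a" if "a' \<in> ?A" for a'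
      using Max_ge[OF fin imageI[OF that]] a(2) by simp
    ultimately show ?thesis by blast
  qed
  have prime: "f \<in> ?Q \<or> g \<in> ?Q" if fg: "f * g \<in> ?Q" for f g :: "('v, 'k) mpoly"
  proof (rule ccontr)
    assume "\<not> (f \<in> ?Q \<or> g \<in> ?Q)"
    then obtain a b where a: "a \<in> Poly_Mapping.keys f" "avoids a"
        "\<And>a'. a' \<in> Poly_Mapping.keys f \<Longrightarrow> avoids a' \<Longrightarrow> ord a' \<le> ord a"
      and b: "b \<in> Poly_Mapping.keys g" "avoids b"
        "\<And>b'. b' \<in> Poly_Mapping.keys g \<Longrightarrow> avoids b' \<Longrightarrow> ord b' \<le> ord b"
      using leading[of f] leading[of g] by blast
    have unique: "a' = a \<and> b' = b"
      if "a' \<in> Poly_Mapping.keys f" "b' \<in> Poly_Mapping.keys g" "a' + b' = a + b" for a' b'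
    proof -
      have "avoids a'" "avoids b'" using a(2) b(2) that(3) avoids_add by metis+
      then have le: "ord a' \<le> ord a" "ord b' \<le> ord b" using a(3) b(3) that by auto
      moreover have "ord a' + ord b' = ord a + ord b"
        using that(3) ord_add by metis
      ultimately have "ord a' = ord a" "ord b' = ord b"
        by (metis add_less_le_mono order.not_eq_order_implies_strict order_less_irrefl)
          (metis \<open>ord a' + ord b' = ord a + ord b\<close> add_le_less_mono le order.not_eq_order_implies_strict order_less_irrefl)
      then show ?thesis using ord_inj by blast
    qed
    have "Poly_Mapping.lookup (f * g) (a + b) =
        (\<Sum>p\<in>{(a, b)}. Poly_Mapping.lookup f (fst p) * Poly_Mapping.lookup g (snd p))"
      unfolding lookup_times
    proof (rule sum.mono_neutral_cong_right)
      show "\<forall>p\<in>Poly_Mapping.keys f \<times> Poly_Mapping.keys g - {(a, b)}.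
          (case p of (a', b') \<Rightarrow> if a' + b' = a + b
            then Poly_Mapping.lookup f a' * Poly_Mapping.lookup g b' else 0) = 0"
        using unique by fastforce
    qed (use a(1) b(1) in simp_all)
    then have "a + b \<in> Poly_Mapping.keys (f * g)" using a(1) b(1) by (simp add: in_keys_iff)
    then show False using fg a(2) b(2) by (auto simp: Q avoids_add)
  qed
  show ?thesis
  proof (rule primeidealI)
    show "cring (poly_ring :: ('v, 'k) mpoly ring)" by (rule cring_from_type_algebra)
    show "ideal ?Q poly_ring"
      unfolding ideal_type_algebra_iff Q
    proof (intro conjI ballI allI)
      fix f g :: "('v, 'k) mpoly"
      assume "f \<in> {f. \<forall>m\<in>Poly_Mapping.keys f. \<not> avoids m}" "g \<in> {f. \<forall>m\<in>Poly_Mapping.keys f. \<not> avoids m}"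
      then show "f + g \<in> {f. \<forall>m\<in>Poly_Mapping.keys f. \<not> avoids m}"
        using keys_add[of f g] by auto
    next
      fix f r :: "('v, 'k) mpoly"
      assume "f \<in> {f. \<forall>m\<in>Poly_Mapping.keys f. \<not> avoids m}"
      then show "r * f \<in> {f. \<forall>m\<in>Poly_Mapping.keys f. \<not> avoids m}"
        using keys_mult[of r f] by (auto simp: subset_iff avoids_add)
    qed simp
    have "1 \<notin> ?Q" by simp
    moreover have "(1 :: ('v, 'k) mpoly) \<in> carrier poly_ring"
      by (simp add: ring_of_type_algebra_def)
    ultimately show "carrier poly_ring \<noteq> ?Q" by metis
  qed (use prime in \<open>auto simp: ring_of_type_algebra_def\<close>)
qed

text \<open>
  If \<open>u\<close> and \<open>w\<close> are equal or not adjacent, then \<open>{u, w}\<close> extends to a maximal set \<open>S\<close> without edges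
  between distinct members. Let \<open>M\<close> be the product of its variables and \<open>W\<close> the set of vertices \<open>v\<close>
  with \<open>M v\<close> in the edge ideal. Then \<open>W\<close> contains all neighbours of members of \<open>S\<close>, and by maximality
  all vertices outside \<open>S\<close>. The members of \<open>S\<close> missing from \<open>W\<close> are therefore not adjacent to anything
  in \<open>S\<close>, so \<open>I : M\<close> is generated by \<open>W\<close>.
\<close>
lemma joined_neighbours_if_regular_edge:
  fixes E :: "'v::finite set set"
  assumes reg: "regular_edge TYPE('k::field) E x y"
  shows "joined_neighbours E x y"
proof (rule ccontr)
  assume "\<not> joined_neighbours E x y"
  then obtain u w where u: "u \<in> nbhd E x" and w: "w \<in> nbhd E y" and uw: "u = w \<or> {u, w} \<notin> E"
    by (auto simp: joined_neighbours_def)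
  define indep where "indep S \<longleftrightarrow> (\<forall>a\<in>S. \<forall>b\<in>S. a \<noteq> b \<longrightarrow> {a, b} \<notin> E)" for S
  have "indep {u, w}" using uw by (auto simp: indep_def insert_commute)
  then obtain S where S: "indep S" "u \<in> S" "w \<in> S"
    and max: "\<And>T. indep T \<Longrightarrow> S \<subseteq> T \<Longrightarrow> T = S"
    using finite_has_maximal2[of "Collect indep" "{u, w}"] by auto
  have outside: "\<exists>b\<in>S. {a, b} \<in> E" if "a \<notin> S" for a
  proof (rule ccontr)
    assume "\<not> ?thesis"
    then have "indep (insert a S)" using S(1) by (auto simp: indep_def insert_commute)
    then show False using max[of "insert a S"] that by blast
  qed
  define M :: "'v \<Rightarrow>\<^sub>0 nat" where "M = (\<Sum>v\<in>S. Poly_Mapping.single v 1)"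
  have M: "Poly_Mapping.lookup M v = (if v \<in> S then 1 else 0)" for v
    by (simp add: M_def lookup_sum lookup_single when_def sum.delta')
  define W where "W = {v. edge_monomial E (M + Poly_Mapping.single v 1)}"
  have W: "v \<in> W" if "{a, v} \<in> E" "a \<in> S" for a v
    unfolding W_def mem_Collect_eq
    by (rule edge_monomialI[OF that(1)])
       (use that(2) in \<open>simp_all add: lookup_add lookup_single when_def M\<close>)
  have outside_W: "v \<in> W" if "v \<notin> S" for v
    using outside[OF that] W by (auto simp: insert_commute)
  have mult_iff: "edge_monomial E (k + M) \<longleftrightarrow> (\<exists>v\<in>W. 0 < Poly_Mapping.lookup k v)" for k
  proof
    assume "edge_monomial E (k + M)"
    then obtain a b where ab: "{a, b} \<in> E" "0 < Poly_Mapping.lookup (k + M) a"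
      "0 < Poly_Mapping.lookup (k + M) b" "a = b \<longrightarrow> 2 \<le> Poly_Mapping.lookup (k + M) a"
      by (auto simp: edge_monomial_def)
    show "\<exists>v\<in>W. 0 < Poly_Mapping.lookup k v"
    proof (cases "a \<in> S \<and> b \<in> S")
      case True
      then have "a = b" using S(1) ab(1) by (auto simp: indep_def)
      then show ?thesis using True ab W[of a a] by (intro bexI[of _ a]) (auto simp: lookup_add M)
    next
      case False
      then show ?thesis using ab(2,3) outside_W by (auto simp: lookup_add M split: if_splits)
    qed
  next
    assume "\<exists>v\<in>W. 0 < Poly_Mapping.lookup k v"
    then obtain v where v: "v \<in> W" "0 < Poly_Mapping.lookup k v" by blast
    have "k = Poly_Mapping.single v 1 + (k - Poly_Mapping.single v 1)"
      using v(2) by (intro poly_mapping_eqI) (auto simp: lookup_add lookup_minus lookup_single when_def)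
    then have "k + M = (M + Poly_Mapping.single v 1) + (k - Poly_Mapping.single v 1)"
      by (metis add.assoc add.commute)
    then show "edge_monomial E (k + M)"
      using v(1) edge_monomial_add unfolding W_def by (metis mem_Collect_eq)
  qed
  define Q :: "('v, 'k) mpoly set"
    where "Q = {f. \<forall>m\<in>Poly_Mapping.keys f. \<exists>v\<in>W. 0 < Poly_Mapping.lookup m v}"
  have "Q = {f \<in> carrier poly_ring. f \<otimes>\<^bsub>poly_ring\<^esub> Poly_Mapping.single M 1 \<in> edge_ideal E}"
    by (auto simp: Q_def mem_edge_ideal_iff keys_times_single mult_iff ring_of_type_algebra_def)
  moreover have "primeideal Q poly_ring"
    unfolding Q_def by (rule primeideal_variables)
  ultimately have "Q \<in> associated_primes poly_ring (edge_module E)"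
    unfolding edge_module_def ideal.associated_primes_quot_module[OF edge_ideal_ideal]
    by (auto simp: ring_of_type_algebra_def)
  moreover have "var v \<in> Q" if "v \<in> W" for v
    using that by (auto simp: Q_def var_def intro!: bexI[of _ v])
  then have "var x \<in> Q" "var y \<in> Q"
    using u w S(2,3) W by (auto simp: nbhd_def)
  then have "var x * var y \<in> ideal_prod poly_ring Q Q"
    using ideal_prod.prod[of "var x" Q "var y" Q poly_ring] by (simp add: ring_of_type_algebra_def)
  ultimately show False using reg by (auto simp: regular_edge_def)
qed

section \<open>Substitution of polynomials for the variables\<close>

definition subst :: "('v::finite \<Rightarrow> ('v, 'k::field) mpoly) \<Rightarrow> ('v, 'k) mpoly \<Rightarrow> ('v, 'k) mpoly"
  where "subst \<sigma> f = (\<Sum>m\<in>Poly_Mapping.keys f.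
    Poly_Mapping.single 0 (Poly_Mapping.lookup f m) * (\<Prod>v\<in>UNIV. \<sigma> v ^ Poly_Mapping.lookup m v))"

lemma subst_add: "subst \<sigma> (f + g) = subst \<sigma> f + subst \<sigma> g"
  unfolding subst_def
  by (rule setsum_keys_plus_distrib) (simp_all add: single_add distrib_right)

lemma subst_0 [simp]: "subst \<sigma> 0 = 0"
  by (simp add: subst_def)

lemma subst_sum: "subst \<sigma> (\<Sum>i\<in>A. f i) = (\<Sum>i\<in>A. subst \<sigma> (f i))"
  by (induction A rule: infinite_finite_induct) (simp_all add: subst_add)

lemma subst_single:
  "subst \<sigma> (Poly_Mapping.single m c) =
    Poly_Mapping.single 0 c * (\<Prod>v\<in>UNIV. \<sigma> v ^ Poly_Mapping.lookup m v)"
  by (cases "c = 0") (simp_all add: subst_def)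

lemma subst_single_times_single:
  "subst \<sigma> (Poly_Mapping.single m c * Poly_Mapping.single n d) =
    subst \<sigma> (Poly_Mapping.single m c) * subst \<sigma> (Poly_Mapping.single n d)"
proof -
  have "Poly_Mapping.single 0 (c * d) = Poly_Mapping.single (0 :: 'a \<Rightarrow>\<^sub>0 nat) c * Poly_Mapping.single 0 d"
    by (simp add: mult_single)
  then show ?thesis
    by (simp only: mult_single[of m] subst_single) (simp add: lookup_add power_add prod.distrib ac_simps)
qed

lemma subst_mult: "subst \<sigma> (f * g) = subst \<sigma> f * subst \<sigma> g"
proof -
  let ?mono = "\<lambda>h m. Poly_Mapping.single m (Poly_Mapping.lookup h m)"
  have "subst \<sigma> (sum (?mono f) (Poly_Mapping.keys f) * sum (?mono g) (Poly_Mapping.keys g)) =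
      subst \<sigma> (sum (?mono f) (Poly_Mapping.keys f)) * subst \<sigma> (sum (?mono g) (Poly_Mapping.keys g))"
    by (simp only: sum_product subst_sum subst_single_times_single)
  then show ?thesis by (simp only: poly_mapping_eq_sum_single[symmetric])
qed

lemma subst_const [simp]: "subst \<sigma> (Poly_Mapping.single 0 c) = Poly_Mapping.single 0 c"
  by (simp add: subst_single)

lemma subst_var [simp]: "subst \<sigma> (var v) = \<sigma> v"
proof -
  have "(\<Prod>u\<in>UNIV. \<sigma> u ^ Poly_Mapping.lookup (Poly_Mapping.single v 1) u) =
      (\<Prod>u\<in>UNIV. if u = v then \<sigma> u else 1)"
    by (intro prod.cong) (auto simp: lookup_single when_def)
  then show ?thesis by (simp add: var_def subst_single)
qed

lemma single_eq_prod_var: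
  "(Poly_Mapping.single m c :: ('v::finite, 'k::field) mpoly) =
    Poly_Mapping.single 0 c * (\<Prod>v\<in>UNIV. var v ^ Poly_Mapping.lookup m v)"
proof -
  have "(var v ^ n :: ('v, 'k) mpoly) = Poly_Mapping.single (Poly_Mapping.single v n) 1" for v n
    by (induction n) (simp_all add: var_def mult_single flip: single_add)
  moreover have "(\<Prod>v\<in>A. Poly_Mapping.single (g v) 1 :: ('v, 'k) mpoly) =
      Poly_Mapping.single (\<Sum>v\<in>A. g v) 1" for g and A :: "'v set"
    by (induction A rule: infinite_finite_induct) (simp_all add: mult_single)
  moreover have "(\<Sum>v\<in>UNIV. Poly_Mapping.single v (Poly_Mapping.lookup m v)) = m"
    by (rule poly_mapping_eqI) (simp add: lookup_sum lookup_single when_def)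
  ultimately show ?thesis by (simp add: mult_single)
qed

text \<open>Constants and variables generate the polynomials as a ring.\<close>
lemma mpoly_induct [case_names const var add mult]:
  fixes f :: "('v::finite, 'k::field) mpoly"
  assumes const: "\<And>c. P (Poly_Mapping.single 0 c)"
    and var: "\<And>v. P (var v)"
    and add: "\<And>f g. P f \<Longrightarrow> P g \<Longrightarrow> P (f + g)"
    and mult: "\<And>f g. P f \<Longrightarrow> P g \<Longrightarrow> P (f * g)"
  shows "P f"
proof -
  have zero: "P 0" and one: "P 1" using const[of 0] const[of 1] by simp_all
  have power: "P (var v ^ n)" for v n
    by (induction n) (simp_all add: one var mult)
  have "P (\<Prod>v\<in>A. var v ^ h v)" for A h
    by (induction A rule: infinite_finite_induct) (simp_all add: one power mult)
  then have "P (Poly_Mapping.single m c)" for m c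
    by (subst single_eq_prod_var) (intro mult const)
  then have "P (\<Sum>m\<in>A. Poly_Mapping.single m (Poly_Mapping.lookup f m))" for A
    by (induction A rule: infinite_finite_induct) (simp_all add: zero add)
  then show ?thesis by (subst poly_mapping_eq_sum_single)
qed

section \<open>Contracting edges\<close>

text \<open>The sign is chosen so that this substitution sends \<open>var v + var (p v)\<close> to \<open>0\<close>.\<close>
definition contraction :: "('v \<Rightarrow> 'v) \<Rightarrow> 'v \<Rightarrow> ('v, 'k::field) mpoly"
  where "contraction p v = (if p v = v then var v else - var (p v))"

text \<open>
  Here \<open>p\<close> collapses the vertices onto representatives. The substitution sends the generators of the
  ideal on the left into the edge ideal of the image graph, because it sends edges to edges up to sign.
  Conversely, it changes a polynomial only by an element of the ideal on the left, so that ideal also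
  contains the edge ideal of the image graph; here it matters that every edge of the image comes from a
  set with at most two elements.
\<close>
lemma mem_ideal_contraction_iff:
  fixes f :: "('v::finite, 'k::field) mpoly"
  assumes graph: "loop_graph E" and p: "\<And>v. p (p v) = p v"
  shows "f \<in> Idl\<^bsub>poly_ring\<^esub> (edge_ideal E \<union> {var v + var (p v) | v. p v \<noteq> v}) \<longleftrightarrow>
    subst (contraction p) f \<in> edge_ideal ((`) p ` E)"
proof
  let ?F = "{var v + var (p v) | v. p v \<noteq> v} :: ('v, 'k) mpoly set"
  define J where "J = Idl\<^bsub>poly_ring\<^esub> (edge_ideal E \<union> ?F)"
  interpret R: ring "poly_ring :: ('v, 'k) mpoly ring" by (rule ring_from_type_algebra)
  have univ: "carrier (poly_ring :: ('v, 'k) mpoly ring) = UNIV"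
    by (simp add: ring_of_type_algebra_def)
  have J_ideal: "ideal J poly_ring"
    unfolding J_def by (rule R.genideal_ideal) (simp add: univ)
  then have J0: "0 \<in> J" and J_add: "\<And>a b. a \<in> J \<Longrightarrow> b \<in> J \<Longrightarrow> a + b \<in> J"
    and J_mult: "\<And>a r. a \<in> J \<Longrightarrow> r * a \<in> J"
    by (simp_all add: ideal_type_algebra_iff)
  have J_gen: "edge_ideal E \<union> ?F \<subseteq> J"
    unfolding J_def by (rule R.genideal_self) (simp add: univ)
  define I' where "I' = (edge_ideal ((`) p ` E) :: ('v, 'k) mpoly set)"
  have I'_ideal: "ideal I' poly_ring" unfolding I'_def by (rule edge_ideal_ideal)
  then have I'0: "0 \<in> I'" and I'_add: "\<And>a b. a \<in> I' \<Longrightarrow> b \<in> I' \<Longrightarrow> a + b \<in> I'"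
    and I'_mult: "\<And>a r. a \<in> I' \<Longrightarrow> r * a \<in> I'"
    by (simp_all add: ideal_type_algebra_iff)
  have uminus_I': "- a \<in> I'" if "a \<in> I'" for a
    using I'_mult[OF that, of "- 1"] by simp
  have uminus_J: "- a \<in> J" if "a \<in> J" for a
    using J_mult[OF that, of "- 1"] by simp
  let ?\<phi> = "subst (contraction p) :: ('v, 'k) mpoly \<Rightarrow> _"
  define P where "P = {f. ?\<phi> f \<in> I'}"
  have "ideal P poly_ring"
    by (auto simp: P_def ideal_type_algebra_iff subst_add subst_mult I'0 I'_add I'_mult)
  moreover have "edge_ideal E \<subseteq> P"
    unfolding edge_ideal_def
  proof (rule R.genideal_minimal[OF \<open>ideal P poly_ring\<close>], safe)
    fix u v assume "{u, v} \<in> E"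
    then have "p ` {u, v} \<in> (`) p ` E" by (rule imageI)
    then have "{p u, p v} \<in> (`) p ` E" by simp
    then have "var (p u) * var (p v) \<in> I'" unfolding I'_def by (rule edge_ideal_generator)
    then show "var u * var v \<in> P"
      using uminus_I'[of "var (p u) * var (p v)"] by (auto simp: P_def subst_mult contraction_def)
  qed
  moreover have "?F \<subseteq> P"
    using p I'0 by (auto simp: P_def subst_add contraction_def)
  ultimately have "J \<subseteq> P" unfolding J_def by (intro R.genideal_minimal) auto
  {
    assume "f \<in> Idl\<^bsub>poly_ring\<^esub> (edge_ideal E \<union> ?F)"
    then show "?\<phi> f \<in> edge_ideal ((`) p ` E)"
      using \<open>J \<subseteq> P\<close> by (auto simp: J_def P_def I'_def)
  }
  have cong: "g - ?\<phi> g \<in> J" for g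
  proof (induction g rule: mpoly_induct)
    case (var v)
    then show ?case using J_gen J0 by (auto simp: contraction_def)
  next
    case (add f g)
    then show ?case using J_add[OF add] by (simp add: subst_add algebra_simps)
  next
    case (mult f g)
    have "f * g - ?\<phi> (f * g) = f * (g - ?\<phi> g) + ?\<phi> g * (f - ?\<phi> f)"
      by (simp add: subst_mult algebra_simps)
    then show ?case using J_add J_mult mult by metis
  qed (simp add: J0)
  have "var a * var b \<in> J" if ab: "{a, b} \<in> (`) p ` E" for a b
  proof -
    obtain e where e: "e \<in> E" "{a, b} = p ` e" using ab by blast
    obtain u v where uv: "e = {u, v}" using graph e(1) by (auto simp: loop_graph_def)
    have "var u * var v \<in> (edge_ideal E :: ('v, 'k) mpoly set)"
      using e(1) uv by (intro edge_ideal_generator) simp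
    then have "var u * var v \<in> J" using J_gen by auto
    moreover have \<phi>_uv: "?\<phi> (var u * var v) = var (p u) * var (p v) \<or>
        ?\<phi> (var u * var v) = - (var (p u) * var (p v))"
      by (auto simp: subst_mult contraction_def)
    ultimately have "?\<phi> (var u * var v) \<in> J"
      using J_add[OF _ uminus_J[OF cong[of "var u * var v"]], of "var u * var v"] by simp
    then have "var (p u) * var (p v) \<in> J"
      using uminus_J[of "?\<phi> (var u * var v)"] \<phi>_uv by (metis minus_minus)
    moreover have "var a * var b = (var (p u) * var (p v) :: ('v, 'k) mpoly)"
      using e(2) uv by (auto simp: doubleton_eq_iff mult.commute)
    ultimately show ?thesis by simp
  qed
  then have "I' \<subseteq> J"
    unfolding I'_def edge_ideal_def by (intro R.genideal_minimal[OF J_ideal]) blast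
  assume "?\<phi> f \<in> edge_ideal ((`) p ` E)"
  then have "?\<phi> f \<in> J" using \<open>I' \<subseteq> J\<close> by (auto simp: I'_def)
  then show "f \<in> Idl\<^bsub>poly_ring\<^esub> (edge_ideal E \<union> ?F)"
    using J_add[OF cong[of f], of "?\<phi> f"] by (simp add: J_def)
qed

section \<open>Regular sequences from disjoint regular edges\<close>

text \<open>
  Regularity is replaced here by \<open>joined_neighbours\<close>, a condition on the graph that does not refer to
  the coefficient field.
\<close>
locale disjoint_regular_edges =
  fixes E :: "'v::finite set set" and x y :: "nat \<Rightarrow> 'v" and n :: nat
  assumes graph: "loop_graph E"
    and edge: "i \<in> {1..n} \<Longrightarrow> {x i, y i} \<in> E"
    and joined: "i \<in> {1..n} \<Longrightarrow> joined_neighbours E (x i) (y i)"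
    and disjoint: "i \<in> {1..n} \<Longrightarrow> j \<in> {1..n} \<Longrightarrow> i \<noteq> j \<Longrightarrow> {x i, y i} \<inter> {x j, y j} = {}"
begin

text \<open>
  This contracts the edges with index below \<open>i\<close>, keeping \<open>x j\<close> as the representative of
  \<open>{x j, y j}\<close>. Its properties hold for \<open>i \<le> n + 1\<close>; the value \<open>n + 1\<close> contracts all edges and gives
  the ideal of the whole sequence.
\<close>
definition merge :: "nat \<Rightarrow> 'v \<Rightarrow> 'v"
  where "merge i v = (if v \<in> y ` {1..<i} then x (inv_into {1..<i} y v) else v)"

lemma x_neq_y:
  assumes "i \<in> {1..n}" "j \<in> {1..n}"
  shows "x i \<noteq> y j"
  using joined_neighbours_neq(1)[OF edge joined, of i] disjoint[of i j] assms by (cases "i = j") auto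

lemma merge_y:
  assumes "i \<le> Suc n" "j \<in> {1..<i}"
  shows "merge i (y j) = x j"
proof -
  have "inj_on y {1..<i}"
    using assms(1) disjoint by (fastforce simp: inj_on_def)
  then show ?thesis using assms(2) by (simp add: merge_def)
qed

lemma merge_eq: "v \<notin> y ` {1..<i} \<Longrightarrow> merge i v = v"
  by (simp add: merge_def)

lemma merge_x: "i \<le> Suc n \<Longrightarrow> j \<in> {1..n} \<Longrightarrow> merge i (x j) = x j"
  using x_neq_y by (intro merge_eq) auto

lemma merge_merge:
  assumes "i \<le> Suc n"
  shows "merge i (merge i v) = merge i v"
proof (cases "v \<in> y ` {1..<i}")
  case True
  then obtain j where "j \<in> {1..<i}" "v = y j" by blast
  then show ?thesis using assms merge_y merge_x by simp
qed (simp add: merge_eq)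

text \<open>
  The two sets of generators are matched through \<open>v = y j\<close>: these are exactly the vertices that
  \<open>merge\<close> moves.
\<close>
lemma merged_generators:
  assumes "i \<le> Suc n"
  shows "{var v + var (merge i v) | v. merge i v \<noteq> v} =
    ((\<lambda>j. var (x j) + var (y j)) ` {1..<i} :: ('v, 'k::field) mpoly set)"
proof safe
  fix v assume v: "merge i v \<noteq> v"
  then obtain j where "j \<in> {1..<i}" "v = y j" using merge_eq by blast
  then show "(var v + var (merge i v) :: ('v, 'k) mpoly) \<in> (\<lambda>j. var (x j) + var (y j)) ` {1..<i}"
    using merge_y[OF assms] by (auto simp: add.commute intro!: image_eqI[of _ _ j])
next
  fix j assume j: "j \<in> {1..<i}"
  then have "merge i (y j) \<noteq> y j" "var (x j) + var (y j) = (var (y j) + var (merge i (y j)) :: ('v, 'k) mpoly)"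
    using merge_y[OF assms j] x_neq_y[of j j] assms by (auto simp: add.commute)
  then show "\<exists>v. (var (x j) + var (y j) :: ('v, 'k) mpoly) = var v + var (merge i v) \<and> merge i v \<noteq> v"
    by blast
qed

lemma mem_partial_ideal_iff:
  fixes f :: "('v, 'k::field) mpoly"
  assumes "i \<le> Suc n"
  shows "f \<in> Idl\<^bsub>poly_ring\<^esub> (edge_ideal E \<union> (\<lambda>j. var (x j) + var (y j)) ` {1..<i}) \<longleftrightarrow>
    subst (contraction (merge i)) f \<in> edge_ideal ((`) (merge i) ` E)"
  using mem_ideal_contraction_iff[OF graph merge_merge[OF assms], of f]
  by (simp only: merged_generators[OF assms])

lemma merge_eq_later_iff:
  assumes i: "i \<in> {1..n}" and a: "a \<in> {x i, y i}"
  shows "merge i v = a \<longleftrightarrow> v = a"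
proof (cases "v \<in> y ` {1..<i}")
  case True
  then obtain j where j: "j \<in> {1..<i}" "v = y j" by blast
  then have "{x i, y i} \<inter> {x j, y j} = {}" using disjoint[of i j] i by auto
  then show ?thesis using j merge_y[of i j] a i by auto
qed (simp add: merge_eq)

lemma nbhd_merged:
  assumes "i \<in> {1..n}" "a \<in> {x i, y i}"
  shows "nbhd ((`) (merge i) ` E) a \<subseteq> merge i ` nbhd E a"
proof
  fix u assume "u \<in> nbhd ((`) (merge i) ` E) a"
  then obtain e where e: "e \<in> E" "{u, a} = merge i ` e" by (auto simp: nbhd_def)
  obtain b c where bc: "e = {b, c}" using graph e(1) by (auto simp: loop_graph_def)
  have "(merge i b = u \<and> merge i c = a) \<or> (merge i c = u \<and> merge i b = a)"
    using e(2) bc by (auto simp: doubleton_eq_iff)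
  then have "(merge i b = u \<and> c = a) \<or> (merge i c = u \<and> b = a)"
    using merge_eq_later_iff[OF assms] by blast
  then show "u \<in> merge i ` nbhd E a"
    using e(1) bc by (auto simp: nbhd_def insert_commute)
qed

lemma merge_eq_imp:
  assumes i: "i \<in> {1..n}" and eq: "merge i u = merge i w" and neq: "u \<noteq> w"
  shows "\<exists>j\<in>{1..<i}. u \<in> {x j, y j} \<and> w \<in> {x j, y j}"
proof -
  have y_case: "\<exists>j\<in>{1..<i}. v \<in> {x j, y j} \<and> v' \<in> {x j, y j}"
    if v: "v \<in> y ` {1..<i}" and vv: "merge i v = merge i v'" for v v'
  proof -
    obtain j where j: "j \<in> {1..<i}" "v = y j" using v by blast
    have xj: "merge i v' = x j" using vv j merge_y[of i j] i by simp
    have "v' \<in> {x j, y j}"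
    proof (cases "v' \<in> y ` {1..<i}")
      case True
      then obtain l where l: "l \<in> {1..<i}" "v' = y l" by blast
      then have "x l = x j" using xj merge_y[of i l] i by simp
      then have "l = j" using disjoint[of l j] l(1) j(1) i by auto
      then show ?thesis using l by simp
    qed (use xj in \<open>simp add: merge_eq\<close>)
    then show ?thesis using j by blast
  qed
  show ?thesis
  proof (cases "u \<in> y ` {1..<i}")
    case True
    then show ?thesis using y_case[OF _ eq] by blast
  next
    case False
    then have "w \<in> y ` {1..<i}" using eq neq by (metis merge_eq)
    then show ?thesis using y_case[OF _ eq[symmetric]] by blast
  qed
qed

text \<open>
  Adjacency is inherited by the images of the neighbours. Distinctness could only fail if a neighbour of
  \<open>x i\<close> and a neighbour of \<open>y i\<close> lay on a common earlier edge, and then neither disjunct of the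
  hypothesis on neighbourhoods would hold.
\<close>
lemma joined_neighbours_merged:
  assumes i: "i \<in> {1..n}"
    and avoid: "nbhd E (x i) \<inter> (x ` {1..<i} \<union> y ` {1..<i}) = {} \<or>
      nbhd E (y i) \<inter> (x ` {1..<i} \<union> y ` {1..<i}) = {}"
  shows "joined_neighbours ((`) (merge i) ` E) (x i) (y i)"
  unfolding joined_neighbours_def
proof (intro ballI)
  fix u' w'
  assume "u' \<in> nbhd ((`) (merge i) ` E) (x i)" "w' \<in> nbhd ((`) (merge i) ` E) (y i)"
  then obtain u w where u: "u \<in> nbhd E (x i)" "u' = merge i u"
    and w: "w \<in> nbhd E (y i)" "w' = merge i w"
    using nbhd_merged[OF i, of "x i"] nbhd_merged[OF i, of "y i"] by blast
  have "u \<noteq> w" and uw: "{u, w} \<in> E"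
    using joined[OF i] u w by (auto simp: joined_neighbours_def)
  have "merge i u \<noteq> merge i w"
  proof
    assume "merge i u = merge i w"
    then obtain j where "j \<in> {1..<i}" "u \<in> {x j, y j}" "w \<in> {x j, y j}"
      using merge_eq_imp[OF i _ \<open>u \<noteq> w\<close>] by blast
    then show False using avoid u w by blast
  qed
  moreover have "{merge i u, merge i w} \<in> (`) (merge i) ` E"
    using imageI[OF uw, of "(`) (merge i)"] by simp
  ultimately show "u' \<noteq> w' \<and> {u', w'} \<in> (`) (merge i) ` E" using u w by simp
qed

lemma edge_sum_nonzerodivisor:
  fixes f :: "('v, 'k::field) mpoly"
  assumes i: "i \<in> {1..n}"
    and avoid: "nbhd E (x i) \<inter> (x ` {1..<i} \<union> y ` {1..<i}) = {} \<or>
      nbhd E (y i) \<inter> (x ` {1..<i} \<union> y ` {1..<i}) = {}"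
    and prod: "(var (x i) + var (y i)) * f \<in>
      Idl\<^bsub>poly_ring\<^esub> (edge_ideal E \<union> (\<lambda>j. var (x j) + var (y j)) ` {1..<i})"
  shows "f \<in> Idl\<^bsub>poly_ring\<^esub> (edge_ideal E \<union> (\<lambda>j. var (x j) + var (y j)) ` {1..<i})"
proof -
  have le: "i \<le> Suc n" using i by simp
  have fixed: "merge i (x i) = x i" "merge i (y i) = y i"
    using merge_eq_later_iff[OF i] by auto
  have "{x i, y i} \<in> (`) (merge i) ` E"
    using imageI[OF edge[OF i], of "(`) (merge i)"] fixed by simp
  moreover have "joined_neighbours ((`) (merge i) ` E) (x i) (y i)"
    using joined_neighbours_merged[OF i avoid] .
  moreover have "(var (x i) + var (y i)) * subst (contraction (merge i)) f \<in> edge_ideal ((`) (merge i) ` E)"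
    using prod[unfolded mem_partial_ideal_iff[OF le]] fixed
    by (simp add: subst_mult subst_add contraction_def)
  ultimately have "subst (contraction (merge i)) f \<in> edge_ideal ((`) (merge i) ` E)"
    by (rule vertex_sum_nonzerodivisor)
  then show ?thesis unfolding mem_partial_ideal_iff[OF le] .
qed

text \<open>The monomial \<open>1\<close> is not divisible by any edge, and the substitution fixes it.\<close>
lemma one_not_mem_partial_ideal:
  assumes "i \<le> Suc n"
  shows "(1 :: ('v, 'k::field) mpoly) \<notin>
    Idl\<^bsub>poly_ring\<^esub> (edge_ideal E \<union> (\<lambda>j. var (x j) + var (y j)) ` {1..<i})"
proof -
  have "subst (contraction (merge i)) 1 = (1 :: ('v, 'k) mpoly)"
    using subst_const[of "contraction (merge i)" 1] by simp
  then show ?thesis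
    unfolding mem_partial_ideal_iff[OF assms] by (simp add: mem_edge_ideal_iff edge_monomial_def)
qed

end

theorem theorem5p7:
  fixes E :: "'v::finite set set"
    and x y :: "nat \<Rightarrow> 'v"
    and t :: nat
  assumes graph: "loop_graph E"
    and regular: "\<And>i. i \<in> {1..t} \<Longrightarrow> regular_edge TYPE('k::field) E (x i) (y i)"
    and disjoint: "\<And>i j. i \<in> {1..t} \<Longrightarrow> j \<in> {1..t} \<Longrightarrow> i \<noteq> j \<Longrightarrow> {x i, y i} \<inter> {x j, y j} = {}"
    and nbhds: "\<And>i. i \<in> {2..t} \<Longrightarrow>
      nbhd E (x i) \<inter> (x ` {1..<i} \<union> y ` {1..<i} \<union> loop_vertices E) = {} \<or>
      nbhd E (y i) \<inter> (x ` {1..<i} \<union> y ` {1..<i} \<union> loop_vertices E) = {}"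
  shows "regular_sequence (poly_ring :: ('v, 'k) mpoly ring) (edge_module E)
    (map (\<lambda>i. var (x i) + var (y i)) [1..<Suc t])"
proof -
  interpret disjoint_regular_edges E x y t
  proof
    show "joined_neighbours E (x i) (y i)" if "i \<in> {1..t}" for i
      using joined_neighbours_if_regular_edge[OF regular[OF that]] .
  qed (use graph regular disjoint in \<open>auto simp: regular_edge_def\<close>)
  let ?fs = "map (\<lambda>i. var (x i) + var (y i)) [1..<Suc t] :: ('v, 'k) mpoly list"
  have avoid: "nbhd E (x i) \<inter> (x ` {1..<i} \<union> y ` {1..<i}) = {} \<or>
      nbhd E (y i) \<inter> (x ` {1..<i} \<union> y ` {1..<i}) = {}" if "i \<in> {1..t}" for i
    using nbhds[of i] that by (cases "i = 1") auto
  have take: "set (take k ?fs) = (\<lambda>j. var (x j) + var (y j)) ` {1..<Suc k}" if "k \<le> t" for k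
  proof -
    have "take k [1..<Suc t] = [1..<Suc k]" using that by (simp add: take_upt del: upt_Suc)
    then show ?thesis by (simp add: take_map del: upt_Suc)
  qed
  have nth: "?fs ! k = var (x (Suc k)) + var (y (Suc k))" if "k < t" for k
    using that by (simp del: upt_Suc)
  show ?thesis
    unfolding edge_module_def
      ideal.regular_sequence_quot_module_iff[OF edge_ideal_ideal cring_from_type_algebra]
  proof (intro conjI allI impI ballI)
    fix k and f :: "('v, 'k) mpoly"
    assume k: "k < length ?fs" and prod: "?fs ! k \<otimes>\<^bsub>poly_ring\<^esub> f \<in>
      Idl\<^bsub>poly_ring\<^esub> (edge_ideal E \<union> set (take k ?fs))"
    from k have "k < t" by (simp del: upt_Suc)
    then have i: "Suc k \<in> {1..t}" by simp
    note tk = take[OF less_imp_le[OF \<open>k < t\<close>]]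
    have "(var (x (Suc k)) + var (y (Suc k))) * f \<in>
        Idl\<^bsub>poly_ring\<^esub> (edge_ideal E \<union> (\<lambda>j. var (x j) + var (y j)) ` {1..<Suc k})"
      using prod unfolding tk nth[OF \<open>k < t\<close>] by (simp add: ring_of_type_algebra_def)
    then show "f \<in> Idl\<^bsub>poly_ring\<^esub> (edge_ideal E \<union> set (take k ?fs))"
      unfolding tk by (rule edge_sum_nonzerodivisor[OF i avoid[OF i]])
  next
    have "set ?fs = (\<lambda>j. var (x j) + var (y j)) ` {1..<Suc t}" by (simp del: upt_Suc)
    then show "\<one>\<^bsub>poly_ring\<^esub> \<notin> Idl\<^bsub>poly_ring\<^esub> (edge_ideal E \<union> set ?fs)"
      using one_not_mem_partial_ideal[of "Suc t", where 'k = 'k]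
      by (simp only: ring_of_type_algebra_def monoid.simps order_refl not_False_eq_True)
  qed (simp add: ring_of_type_algebra_def)
qed

end
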